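(* Let $q$ and $n$ be positive integers and let $p=2q$. The number of pairs $(P_1,P_2)$ of planar partitions of $[qn]$ such that $P_1$ is a refinement of $P_2$ and $P_1$ is a $q$-partition (every block of $P_1$ has exactly $q$ elements), with $P_2$ an arbitrary planar partition, equals the Fuss-Catalan number $A_n^{p}=\frac{1}{pn+1}\binom{pn+1}{n}$.
   Context: For a positive integer $N$, $[N]=\{1,\dots,N\}$. A set partition of $[N]$ is planar (non-crossing) if there do not exist $a<b<c<d$ in $[N]$ with $a,c$ in one block and $b,d$ in a different block. A partition $P_1$ is a refinement of $P_2$ if every block of $P_1$ is contained in some block of $P_2$. A $q$-partition of $[qn]$ is a set partition of $[qn]$ all of whose blocks have exactly $q$ elements. *)

theory Defs
  imports Complex_Main "HOL-Library.Disjoint_Sets"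
begin

definition planar_partition :: "nat \<Rightarrow> nat set set \<Rightarrow> bool" where
  "planar_partition N P \<longleftrightarrow> partition_on {1..N} P \<and>
     \<not> (\<exists>a b c d. a < b \<and> b < c \<and> c < d \<and>
          (\<exists>A\<in>P. \<exists>B\<in>P. A \<noteq> B \<and> a \<in> A \<and> c \<in> A \<and> b \<in> B \<and> d \<in> B))"

definition q_partition :: "nat \<Rightarrow> nat \<Rightarrow> nat set set \<Rightarrow> bool" where
  "q_partition q n P \<longleftrightarrow> partition_on {1..q * n} P \<and> (\<forall>B\<in>P. card B = q)"

definition fuss_catalan :: "nat \<Rightarrow> nat \<Rightarrow> real" where
  "fuss_catalan p n = 1 / real (p * n + 1) * real ((p * n + 1) choose n)"

end

theory Submission
  imports Defs "HOL-Computational_Algebra.Formal_Power_Series"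
begin

text \<open>
  Planar partitions are treated as noncrossing equivalence relations on intervals \<open>{a..<b}\<close>. Let \<open>c\<close>
  be the generating function, by length of the interval, of the pairs \<open>R \<subseteq> T\<close> in which all
  \<open>R\<close>-classes have size \<open>q\<close>, and \<open>h\<^sub>k\<close> that of the pairs in which the \<open>R\<close>-class of the
  minimum has size \<open>k\<close> and all others have size \<open>q\<close>. If the minimum \<open>a\<close> is an \<open>R\<close>-singleton,
  cutting at the second element \<open>v\<close> of its \<open>T\<close>-class leaves two independent pairs, on
  \<open>{a+1..<v}\<close> and \<open>{v..<b}\<close>, so \<open>h\<^sub>1 = X c\<^sup>2\<close>. Cutting at the second element of the
  \<open>R\<close>-class of \<open>a\<close> gives \<open>h\<^sub>k\<^sub>+\<^sub>1 = h\<^sub>1 h\<^sub>k\<close>. As \<open>c = 1 + h\<^sub>q\<close>, this yields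
  \<open>c = 1 + X\<^sup>q c\<^sup>2\<^sup>q\<close>. Multiplying by \<open>c\<^sup>r\<close> gives a recurrence for the coefficients of
  the powers of \<open>c\<close>, which the Raney numbers \<open>r / (p n + r) * binomial (p n + r) n\<close> satisfy.
\<close>

section \<open>Noncrossing equivalence relations\<close>

text \<open>Encoding partitions as relations turns cutting the ground set into intersection with a
  square, and refinement into inclusion. The conclusion \<open>(w, x) \<in> R\<close> says that two
  interleaved classes coincide.\<close>

definition nc_equiv :: "nat set \<Rightarrow> (nat \<times> nat) set \<Rightarrow> bool" where
  "nc_equiv S R \<longleftrightarrow> equiv S R \<and>
     (\<forall>w x y z. w < x \<longrightarrow> x < y \<longrightarrow> y < z \<longrightarrow> (w, y) \<in> R \<longrightarrow> (x, z) \<in> R \<longrightarrow> (w, x) \<in> R)"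

text \<open>For relations on adjacent intervals starting at \<open>a\<close> and \<open>u\<close>,
  the two products merge the class of \<open>a\<close> with that of \<open>u\<close>. If
  \<open>R'\<close> is empty they vanish, which covers a cut at the right end of the
  interval.\<close>

definition glue :: "nat \<Rightarrow> nat \<Rightarrow> (nat \<times> nat) set \<Rightarrow> (nat \<times> nat) set \<Rightarrow> (nat \<times> nat) set" where
  "glue a u R R' = R \<union> R' \<union> R `` {a} \<times> R' `` {u} \<union> R' `` {u} \<times> R `` {a}"

lemma nc_equiv_dom: "nc_equiv S R \<Longrightarrow> (x, y) \<in> R \<Longrightarrow> x \<in> S \<and> y \<in> S"
  and nc_equiv_subset: "nc_equiv S R \<Longrightarrow> R \<subseteq> S \<times> S"
  and nc_equiv_refl: "nc_equiv S R \<Longrightarrow> x \<in> S \<Longrightarrow> (x, x) \<in> R"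
  and nc_equiv_sym: "nc_equiv S R \<Longrightarrow> (x, y) \<in> R \<Longrightarrow> (y, x) \<in> R"
  and nc_equiv_trans: "nc_equiv S R \<Longrightarrow> (x, y) \<in> R \<Longrightarrow> (y, z) \<in> R \<Longrightarrow> (x, z) \<in> R"
  and nc_equiv_nc: "nc_equiv S R \<Longrightarrow> w < x \<Longrightarrow> x < y \<Longrightarrow> y < z \<Longrightarrow> (w, y) \<in> R \<Longrightarrow> (x, z) \<in> R
    \<Longrightarrow> (w, x) \<in> R"
  unfolding nc_equiv_def equiv_def refl_on_def sym_def trans_def by blast+

lemma nc_equivI:
  assumes "\<And>x y. (x, y) \<in> R \<Longrightarrow> x \<in> S" "\<And>x. x \<in> S \<Longrightarrow> (x, x) \<in> R"
    "\<And>x y. (x, y) \<in> R \<Longrightarrow> (y, x) \<in> R"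
    "\<And>x y z. (x, y) \<in> R \<Longrightarrow> (y, z) \<in> R \<Longrightarrow> (x, z) \<in> R"
    "\<And>w x y z. w < x \<Longrightarrow> x < y \<Longrightarrow> y < z \<Longrightarrow> (w, y) \<in> R \<Longrightarrow> (x, z) \<in> R \<Longrightarrow> (w, x) \<in> R"
  shows "nc_equiv S R"
proof -
  have "R \<subseteq> S \<times> S" using assms(1,3) by auto
  moreover have "refl_on S R" using assms(2) by (auto intro: refl_onI)
  moreover have "sym R" "trans R" using assms(3) assms(4) unfolding sym_def trans_def by blast+
  ultimately show ?thesis using assms(5) unfolding nc_equiv_def equiv_def by auto
qed

lemma nc_equiv_restrict:
  assumes "nc_equiv S R" "X \<subseteq> S"
  shows "nc_equiv X (R \<inter> X \<times> X)"
proof (rule nc_equivI)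
  fix w x y z assume o: "w < x" "x < y" "y < z" and *: "(w, y) \<in> R \<inter> X \<times> X" "(x, z) \<in> R \<inter> X \<times> X"
  show "(w, x) \<in> R \<inter> X \<times> X" using nc_equiv_nc[OF assms(1) o] * by blast
qed (use assms(2) nc_equiv_refl[OF assms(1)] nc_equiv_sym[OF assms(1)] nc_equiv_trans[OF assms(1)] in blast)+

lemma nc_equiv_Un:
  assumes R: "nc_equiv A R" and R': "nc_equiv B R'" and AB: "\<And>x y. x \<in> A \<Longrightarrow> y \<in> B \<Longrightarrow> x < y"
  shows "nc_equiv (A \<union> B) (R \<union> R')"
proof -
  have disj: "x \<in> A \<Longrightarrow> x \<notin> B" for x using AB[of x x] by blast
  have dom: "(x, y) \<in> R \<Longrightarrow> x \<in> A \<and> y \<in> A" "(x, y) \<in> R' \<Longrightarrow> x \<in> B \<and> y \<in> B" for x y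
    using nc_equiv_dom[OF R] nc_equiv_dom[OF R'] by blast+
  show ?thesis
  proof (rule nc_equivI)
    fix w x y z assume o: "w < x" "x < y" "y < z" and *: "(w, y) \<in> R \<union> R'" "(x, z) \<in> R \<union> R'"
    have "\<not> ((w, y) \<in> R \<and> (x, z) \<in> R')" "\<not> ((w, y) \<in> R' \<and> (x, z) \<in> R)"
      using dom[of w y] dom[of x z] AB[of y x] AB[of z y] o by auto
    thus "(w, x) \<in> R \<union> R'" using * nc_equiv_nc[OF R o] nc_equiv_nc[OF R' o] by blast
  next
    fix x y z assume "(x, y) \<in> R \<union> R'" "(y, z) \<in> R \<union> R'"
    thus "(x, z) \<in> R \<union> R'"
      using disj[of y] dom[of x y] dom[of y z] nc_equiv_trans[OF R, of x y z] nc_equiv_trans[OF R', of x y z]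
      by blast
  next
    fix x y assume "(x, y) \<in> R \<union> R'"
    thus "(y, x) \<in> R \<union> R'" using nc_equiv_sym[OF R] nc_equiv_sym[OF R'] by blast
  qed (use dom nc_equiv_refl[OF R] nc_equiv_refl[OF R'] in blast)+
qed

section \<open>Gluing adjacent intervals along the classes of their minima\<close>

text \<open>Both \<open>a\<close> and \<open>u\<close> are minima of their intervals. A class that
  straddles an element of the class of its own minimum would already cross that class, so the merger
  creates no new crossing.\<close>

lemma nc_equiv_glue:
  assumes R: "nc_equiv {a..<u} R" and R': "nc_equiv {u..<b} R'" and "a < u" "u \<le> b"
  shows "nc_equiv {a..<b} (glue a u R R')"
proof -
  have dom: "(x, y) \<in> R \<Longrightarrow> a \<le> x \<and> x < u \<and> a \<le> y \<and> y < u" for x y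
    using nc_equiv_dom[OF R, of x y] by auto
  have dom': "(x, y) \<in> R' \<Longrightarrow> u \<le> x \<and> x < b \<and> u \<le> y \<and> y < b" for x y
    using nc_equiv_dom[OF R', of x y] by auto
  note s = nc_equiv_sym[OF R] nc_equiv_sym[OF R']
  note t = nc_equiv_trans[OF R] nc_equiv_trans[OF R']
  have iff: "(x, y) \<in> glue a u R R' \<longleftrightarrow> (x, y) \<in> R \<or> (x, y) \<in> R' \<or>
      (a, x) \<in> R \<and> (u, y) \<in> R' \<or> (u, x) \<in> R' \<and> (a, y) \<in> R" for x y
    by (auto simp: glue_def)
  show ?thesis
  proof (rule nc_equivI)
    fix x y assume "(x, y) \<in> glue a u R R'"
    thus "x \<in> {a..<b}" using dom dom' assms(3,4) unfolding iff by fastforce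
  next
    fix x assume "x \<in> {a..<b}"
    thus "(x, x) \<in> glue a u R R'" unfolding iff
      using nc_equiv_refl[OF R, of x] nc_equiv_refl[OF R', of x] by (cases "x < u") auto
  next
    fix x y assume "(x, y) \<in> glue a u R R'"
    thus "(y, x) \<in> glue a u R R'" unfolding iff using s by blast
  next
    fix x y z assume "(x, y) \<in> glue a u R R'" "(y, z) \<in> glue a u R R'"
    moreover have "\<not> ((v, y) \<in> R \<and> (y, w) \<in> R')" "\<not> ((v, y) \<in> R' \<and> (y, w) \<in> R)"
       "\<not> ((v, y) \<in> R' \<and> (w, y) \<in> R)" for v w using dom[of v y] dom[of y w] dom[of w y] dom'[of v y] dom'[of y w] by auto
    ultimately show "(x, z) \<in> glue a u R R'" unfolding iff using s t by meson
  next
    fix w x y z assume o: "w < x" "x < y" "y < z"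
      and *: "(w, y) \<in> glue a u R R'" "(x, z) \<in> glue a u R R'"
    \<comment> \<open>Unless \<open>w = a\<close>, the pairs \<open>(a, x)\<close> and
      \<open>(w, y)\<close> interleave, which puts \<open>w\<close> into the class of
      \<open>a\<close>; \<open>right\<close> is the analogue with \<open>u\<close>.\<close>
    have left: "(a, x) \<in> R \<Longrightarrow> (w, y) \<in> R \<Longrightarrow> (w, x) \<in> R"
      using nc_equiv_nc[OF R, of a w x y] dom[of w y] o s(1)[of a w] t(1)[of w a x] by (cases "a = w") auto
    have right: "(u, y) \<in> R' \<Longrightarrow> (x, z) \<in> R' \<Longrightarrow> (u, x) \<in> R'"
      using nc_equiv_nc[OF R', of u x y z] nc_equiv_refl[OF R', of u] dom'[of x z] o by (cases "u = x") auto
    \<comment> \<open>The cases are the positions of \<open>u\<close> relative to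
      \<open>w < x < y\<close>. In the second, both \<open>w\<close> and \<open>x\<close> are
      related to elements at or beyond \<open>u\<close>, so both lie in the class of
      \<open>a\<close>.\<close>
    consider "y < u" | "x < u" "u \<le> y" | "w < u" "u \<le> x" | "u \<le> w" by linarith
    thus "(w, x) \<in> glue a u R R'"
    proof cases
      case 1
      hence "(w, y) \<in> R" "(a, x) \<in> R \<or> (x, z) \<in> R"
        using * o dom'[of w y] dom'[of u y] dom'[of u w] dom'[of x z] dom'[of u x] unfolding iff by auto
      thus ?thesis using left nc_equiv_nc[OF R o] unfolding iff by blast
    next
      case 2
      hence "(a, w) \<in> R" "(a, x) \<in> R"
        using * o dom[of w y] dom[of a y] dom[of x z] dom[of a z] dom'[of w y] dom'[of x z]
        unfolding iff by auto
      thus ?thesis using s t unfolding iff by blast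
    next
      case 3
      hence "(a, w) \<in> R" "(u, y) \<in> R'" "(x, z) \<in> R'"
        using * o dom[of w y] dom[of a y] dom[of x z] dom[of a x] dom[of a z] dom'[of w y]
        unfolding iff by auto
      thus ?thesis using right unfolding iff by blast
    next
      case 4
      hence "(w, y) \<in> R'" "(x, z) \<in> R'"
        using * o dom[of w y] dom[of a w] dom[of a y] dom[of x z] dom[of a x] dom[of a z]
        unfolding iff by auto
      thus ?thesis using nc_equiv_nc[OF R' o] unfolding iff by blast
    qed
  qed
qed

text \<open>Cutting at an element \<open>u\<close> of the class of \<open>a\<close> loses nothing: a
  pair \<open>(x, y)\<close> with \<open>x < u \<le> y\<close> either shares an endpoint with
  \<open>(a, u)\<close> or crosses it, so it belongs to the class of \<open>a\<close>, which gluing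
  restores.\<close>

lemma glue_restrict:
  assumes R: "nc_equiv {a..<b} R" and au: "(a, u) \<in> R" "a < u"
  shows "glue a u (R \<inter> {a..<u} \<times> {a..<u}) (R \<inter> {u..<b} \<times> {u..<b}) = R"
proof -
  have ub: "u < b" using nc_equiv_dom[OF R au(1)] by auto
  note s = nc_equiv_sym[OF R] and t = nc_equiv_trans[OF R]
  have cross: "(a, x) \<in> R" if xy: "(x, y) \<in> R" and o: "x < u" "u \<le> y" for x y
  proof -
    have "a \<le> x" "(a, a) \<in> R" using nc_equiv_dom[OF R xy] nc_equiv_refl[OF R, of a] by auto
    then consider "x = a" | "y = u" | "a < x" "u < y" using o by linarith
    thus ?thesis
      by cases (use nc_equiv_nc[OF R _ _ _ au(1) xy] xy o s t au \<open>(a, a) \<in> R\<close> in \<open>blast\<close>)+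
  qed
  show ?thesis
  proof (rule set_eqI, clarify)
    fix x y
    show "(x, y) \<in> glue a u (R \<inter> {a..<u} \<times> {a..<u}) (R \<inter> {u..<b} \<times> {u..<b}) \<longleftrightarrow> (x, y) \<in> R" (is "?L \<longleftrightarrow> _")
    proof
      show "?L \<Longrightarrow> (x, y) \<in> R" using t[OF s t[OF au(1)], of x y] t[OF s t[OF s[OF au(1)]], of x y] by (auto simp: glue_def)
      assume xy: "(x, y) \<in> R"
      have d: "x \<in> {a..<b}" "y \<in> {a..<b}" using nc_equiv_dom[OF R xy] by auto
      have c1: "x < u \<Longrightarrow> u \<le> y \<Longrightarrow> (a, x) \<in> R \<and> (u, y) \<in> R"
        using cross[OF xy] t[OF s[OF au(1)] t[OF _ xy]] by blast
      have c2: "y < u \<Longrightarrow> u \<le> x \<Longrightarrow> (a, y) \<in> R \<and> (u, x) \<in> R"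
        using cross[OF s[OF xy]] t[OF s[OF au(1)] t[OF _ s[OF xy]]] by blast
      show ?L using xy d au ub c1 c2 by (auto simp: glue_def not_less)
    qed
  qed
qed

lemma restrict_glue:
  assumes "R \<subseteq> {a..<u} \<times> {a..<u}" "R' \<subseteq> {u..<b} \<times> {u..<b}"
  shows "glue a u R R' \<inter> {a..<u} \<times> {a..<u} = R" "glue a u R R' \<inter> {u..<b} \<times> {u..<b} = R'"
  using assms by (auto simp: glue_def)

lemma glue_mono: "R \<subseteq> T \<Longrightarrow> R' \<subseteq> T' \<Longrightarrow> glue a u R R' \<subseteq> glue a u T T'"
  by (auto simp: glue_def)

section \<open>Decomposing pairs at the second element of a class\<close>

definition uniform_pairs :: "nat \<Rightarrow> nat \<Rightarrow> nat \<Rightarrow> ((nat \<times> nat) set \<times> (nat \<times> nat) set) set" where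
  "uniform_pairs q a b = {(R, T). nc_equiv {a..<b} R \<and> nc_equiv {a..<b} T \<and> R \<subseteq> T \<and>
     (\<forall>x\<in>{a..<b}. card (R `` {x}) = q)}"

text \<open>The class of \<open>a\<close> has a size of its own so that it can be built up one
  element at a time, from 1 to \<open>q\<close>. The condition \<open>a < b\<close> makes the count
  on an empty interval 0 for every \<open>k\<close>.\<close>

definition rooted_pairs :: "nat \<Rightarrow> nat \<Rightarrow> nat \<Rightarrow> nat \<Rightarrow> ((nat \<times> nat) set \<times> (nat \<times> nat) set) set" where
  "rooted_pairs q k a b = {(R, T). a < b \<and> nc_equiv {a..<b} R \<and> nc_equiv {a..<b} T \<and> R \<subseteq> T \<and>
     card (R `` {a}) = k \<and> (\<forall>x\<in>{a..<b}. (a, x) \<notin> R \<longrightarrow> card (R `` {x}) = q)}"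

text \<open>If the class of \<open>a\<close> is a singleton, the end \<open>b\<close> of the interval counts as its second element.\<close>
definition is_next :: "(nat \<times> nat) set \<Rightarrow> nat \<Rightarrow> nat \<Rightarrow> nat \<Rightarrow> bool" where
  "is_next R a b v \<longleftrightarrow> a < v \<and> v \<le> b \<and> (v < b \<longrightarrow> (a, v) \<in> R) \<and> (\<forall>x. (a, x) \<in> R \<longrightarrow> x = a \<or> v \<le> x)"

lemma is_next_unique:
  assumes "is_next R a b v" "is_next R a b w"
  shows "v = w"
  using assms unfolding is_next_def
  by (metis le_antisym le_neq_implies_less less_irrefl nat_le_linear)

lemma is_next_exists:
  assumes "nc_equiv {a..<b} R" "a < b"
  shows "\<exists>v. is_next R a b v"
proof -
  \<comment> \<open>Adjoining \<open>b\<close> keeps the set nonempty and yields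
    \<open>v = b\<close> exactly when the class of \<open>a\<close> is a singleton.\<close>
  define v where "v = Min (insert b (R `` {a} - {a}))"
  have sub: "R `` {a} \<subseteq> {a..<b}" using nc_equiv_dom[OF assms(1)] by blast
  have fin: "finite (insert b (R `` {a} - {a}))" using finite_subset[OF sub] by simp
  have "v \<in> insert b (R `` {a} - {a})" unfolding v_def by (rule Min_in[OF fin]) simp
  moreover have "v \<le> x" if "x \<in> insert b (R `` {a} - {a})" for x unfolding v_def by (rule Min_le[OF fin that])
  ultimately have "is_next R a b v" unfolding is_next_def using sub assms(2) by force
  thus ?thesis by blast
qed

text \<open>Such a pair would end at \<open>v\<close> or cross \<open>(a, v)\<close>, and either way
  place \<open>x\<close> in the class of \<open>a\<close> before its second element. If
  \<open>v = b\<close>, no element at or beyond \<open>v\<close> is left in the interval.\<close>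

lemma is_next_no_cross:
  assumes R: "nc_equiv {a..<b} R" and n: "is_next R a b v" and o: "a < x" "x < v" "v \<le> y"
  shows "(x, y) \<notin> R" "(y, x) \<notin> R"
proof -
  show 1: "(x, y) \<notin> R"
  proof
    assume xy: "(x, y) \<in> R"
    hence "y < b" using nc_equiv_dom[OF R xy] by auto
    hence av: "(a, v) \<in> R" using n o unfolding is_next_def by auto
    have "(a, x) \<in> R"
    proof (cases "y = v")
      case True
      thus ?thesis using xy av nc_equiv_sym[OF R xy] nc_equiv_trans[OF R av] by blast
    next
      case False
      thus ?thesis using nc_equiv_nc[OF R _ _ _ av xy] o by auto
    qed
    thus False using n o unfolding is_next_def by (metis less_irrefl not_le)
  qed
  thus "(y, x) \<notin> R" using nc_equiv_sym[OF R] by blast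
qed

text \<open>Before \<open>v\<close> the class of \<open>a\<close> is just \<open>a\<close>, so the
  left piece carries no more information than the gap strictly between \<open>a\<close> and
  \<open>v\<close>.\<close>

lemma is_next_restrict:
  assumes R: "nc_equiv {a..<b} R" and n: "is_next R a b v"
  shows "R \<inter> {a..<v} \<times> {a..<v} = insert (a, a) (R \<inter> {Suc a..<v} \<times> {Suc a..<v})"
proof -
  have av: "a < v" "v \<le> b" using n unfolding is_next_def by auto
  have "(a, x) \<in> R \<Longrightarrow> x < v \<Longrightarrow> x = a" for x using n unfolding is_next_def by (metis not_le)
  moreover from this have "(x, a) \<in> R \<Longrightarrow> x < v \<Longrightarrow> x = a" for x using nc_equiv_sym[OF R] by blast
  moreover have "(a, a) \<in> R" using nc_equiv_refl[OF R] av by auto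
  ultimately show ?thesis using av by (auto simp: Suc_le_eq le_less; blast)
qed

lemma glue_restrict_next:
  assumes R: "nc_equiv {a..<b} R" and n: "is_next R a b v"
  shows "glue a v (R \<inter> {a..<v} \<times> {a..<v}) (R \<inter> {v..<b} \<times> {v..<b}) = R"
proof (cases "v = b")
  case True
  thus ?thesis using nc_equiv_subset[OF R] by (auto simp: glue_def)
next
  case False
  thus ?thesis using glue_restrict[OF R] n unfolding is_next_def by auto
qed

section \<open>Bijections for the two kinds of cut\<close>

lemma card_eq_by_inverse:
  assumes "\<And>x. x \<in> A \<Longrightarrow> f x \<in> B \<and> g (f x) = x" "\<And>y. y \<in> B \<Longrightarrow> g y \<in> A \<and> f (g y) = y"
  shows "card A = card B"
  by (rule bij_betw_same_card[of f], rule bij_betw_byWitness[of _ g]) (use assms in blast)+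

text \<open>The point \<open>a\<close> is an \<open>R\<close>-singleton, and \<open>v\<close> is its
  successor in \<open>T\<close>. Deleting \<open>a\<close> leaves independent pairs on the gap and
  on \<open>{v..<b}\<close>. In the inverse \<open>g\<close>, the first relation is a plain union,
  while the second is glued so that \<open>a\<close> joins the \<open>T\<close>-class of
  \<open>v\<close>. For \<open>v = b\<close> the right piece is empty.\<close>

lemma rooted_pairs_1_slice:
  assumes v: "a < v" "v \<le> b"
  shows "card {(R, T) \<in> rooted_pairs q 1 a b. is_next T a b v}
    = card (uniform_pairs q (Suc a) v) * card (uniform_pairs q v b)"
proof -
  let ?I = "{Suc a..<v} \<times> {Suc a..<v}" and ?B = "{v..<b} \<times> {v..<b}"
  let ?L = "{(R, T) \<in> rooted_pairs q 1 a b. is_next T a b v}"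
  let ?P = "uniform_pairs q (Suc a) v \<times> uniform_pairs q v b"
  define f :: "(nat \<times> nat) set \<times> (nat \<times> nat) set \<Rightarrow> _" where "f = (\<lambda>(R, T). ((R \<inter> ?I, T \<inter> ?I), (R \<inter> ?B, T \<inter> ?B)))"
  define g where "g = (\<lambda>((R, T), (R', T')). (insert (a, a) (R \<union> R'), glue a v (insert (a, a) T) T'))"
  have subs: "{Suc a..<v} \<subseteq> {a..<b}" "{v..<b} \<subseteq> {a..<b}" using v by auto
  have single: "nc_equiv {a} {(a, a)}" by (rule nc_equivI) auto
  have ins: "nc_equiv {a..<v} (insert (a, a) R)" if "nc_equiv {Suc a..<v} R" for R
  proof -
    have "{a} \<union> {Suc a..<v} = {a..<v}" using v by auto
    thus ?thesis using nc_equiv_Un[OF single that] by auto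
  qed
  have f: "f (R, T) \<in> ?P \<and> g (f (R, T)) = (R, T)" if RT: "(R, T) \<in> ?L" for R T
  proof -
    have R: "nc_equiv {a..<b} R" and T: "nc_equiv {a..<b} T" and sub: "R \<subseteq> T" and c: "card (R `` {a}) = 1"
      and q: "\<And>x. x \<in> {a..<b} \<Longrightarrow> (a, x) \<notin> R \<Longrightarrow> card (R `` {x}) = q" and n: "is_next T a b v"
      using RT unfolding rooted_pairs_def by auto
    have aa: "(a, a) \<in> R" using nc_equiv_refl[OF R] v by auto
    have a1: "(a, x) \<in> R \<longleftrightarrow> x = a" for x
    proof -
      obtain z where "R `` {a} = {z}" using c by (auto simp: card_1_singleton_iff)
      hence "(a, y) \<in> R \<longleftrightarrow> y = z" for y by blast
      thus ?thesis using aa by auto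
    qed
    have a2: "(x, a) \<in> R \<longleftrightarrow> x = a" for x using a1 nc_equiv_sym[OF R] by blast
    \<comment> \<open>The cut is chosen by \<open>T\<close>; that no pair leaves the gap passes down
      to the finer relation \<open>R\<close>.\<close>
    have no: "\<And>x y. a < x \<Longrightarrow> x < v \<Longrightarrow> v \<le> y \<Longrightarrow> (x, y) \<notin> R \<and> (y, x) \<notin> R"
      using is_next_no_cross[OF T n] sub by blast
    have dom: "(x, y) \<in> R \<Longrightarrow> a \<le> x \<and> x < b \<and> a \<le> y \<and> y < b" for x y using nc_equiv_dom[OF R] by force
    have cases: "(x, y) = (a, a) \<or> (x, y) \<in> ?I \<or> (x, y) \<in> ?B" if xy: "(x, y) \<in> R" for x y
    proof (cases "x = a \<or> y = a")
      case True
      thus ?thesis using a1 a2 xy by auto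
    next
      case False
      thus ?thesis using no[of x y] no[of y x] xy dom[OF xy] by (cases "x < v"; cases "y < v") auto
    qed
    have I: "(R \<inter> ?I) `` {x} = R `` {x}" if "x \<in> {Suc a..<v}" for x using that cases[of x] by fastforce
    have B: "(R \<inter> ?B) `` {x} = R `` {x}" if "x \<in> {v..<b}" for x using that cases[of x] v by fastforce
    have "f (R, T) \<in> ?P"
      unfolding f_def uniform_pairs_def
      using nc_equiv_restrict[OF R subs(1)] nc_equiv_restrict[OF R subs(2)] nc_equiv_restrict[OF T subs(1)]
        nc_equiv_restrict[OF T subs(2)] sub I B q a1 v by auto
    moreover have "insert (a, a) (R \<inter> ?I \<union> R \<inter> ?B) = R"
    proof (intro equalityI subrelI)
      fix x y assume "(x, y) \<in> R"
      thus "(x, y) \<in> insert (a, a) (R \<inter> ?I \<union> R \<inter> ?B)" using cases[of x y] by blast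
    qed (use aa in blast)
    moreover have "glue a v (insert (a, a) (T \<inter> ?I)) (T \<inter> ?B) = T"
      using glue_restrict_next[OF T n] is_next_restrict[OF T n] by simp
    ultimately show ?thesis by (simp add: f_def g_def)
  qed
  have g: "g ((R, T), (R', T')) \<in> ?L \<and> f (g ((R, T), (R', T'))) = ((R, T), (R', T'))"
    if RT: "(R, T) \<in> uniform_pairs q (Suc a) v" "(R', T') \<in> uniform_pairs q v b" for R T R' T'
  proof -
    have R: "nc_equiv {Suc a..<v} R" and T: "nc_equiv {Suc a..<v} T" and sub: "R \<subseteq> T"
      and q: "\<And>x. x \<in> {Suc a..<v} \<Longrightarrow> card (R `` {x}) = q"
      and R': "nc_equiv {v..<b} R'" and T': "nc_equiv {v..<b} T'" and sub': "R' \<subseteq> T'"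
      and q': "\<And>x. x \<in> {v..<b} \<Longrightarrow> card (R' `` {x}) = q"
      using RT unfolding uniform_pairs_def by auto
    note dom = nc_equiv_subset[OF R] nc_equiv_subset[OF R'] nc_equiv_subset[OF T] nc_equiv_subset[OF T']
    have un: "{a..<v} \<union> {v..<b} = {a..<b}" using v by auto
    have 1: "nc_equiv {a..<b} (insert (a, a) (R \<union> R'))"
      using nc_equiv_Un[OF ins[OF R] R'] un by auto
    have 2: "nc_equiv {a..<b} (glue a v (insert (a, a) T) T')" by (rule nc_equiv_glue[OF ins[OF T] T' v])
    have 3: "insert (a, a) (R \<union> R') \<subseteq> glue a v (insert (a, a) T) T'" using sub sub' by (auto simp: glue_def)
    have 4: "insert (a, a) (R \<union> R') `` {a} = {a}" using dom v by auto
    have 5: "insert (a, a) (R \<union> R') `` {x} = (if x < v then R `` {x} else R' `` {x})" if "x \<noteq> a" for x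
      using that dom v by auto
    have 6: "is_next (glue a v (insert (a, a) T) T') a b v"
      unfolding is_next_def using v nc_equiv_refl[OF T', of v] dom by (auto simp: glue_def)
    have 7: "glue a v (insert (a, a) T) T' \<inter> ?I = T" "glue a v (insert (a, a) T) T' \<inter> ?B = T'"
      "insert (a, a) (R \<union> R') \<inter> ?I = R" "insert (a, a) (R \<union> R') \<inter> ?B = R'"
      using dom v by (auto simp: glue_def)
    have "card (insert (a, a) (R \<union> R') `` {x}) = q" if "x \<in> {a..<b}" "x \<noteq> a" for x
      using 5[of x] that q[of x] q'[of x] by auto
    hence "g ((R, T), (R', T')) \<in> ?L"
      unfolding g_def rooted_pairs_def using 1 2 3 4 6 v by auto
    thus ?thesis unfolding f_def g_def using 7 by simp
  qed
  have f': "f x \<in> ?P \<and> g (f x) = x" if "x \<in> ?L" for x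
    using that f by (cases x) blast
  have g': "g x \<in> ?L \<and> f (g x) = x" if "x \<in> ?P" for x
  proof -
    obtain R T R' T' where x: "x = ((R, T), (R', T'))" by (metis surj_pair)
    show ?thesis unfolding x by (rule g) (use that x in auto)
  qed
  have "card ?L = card ?P" by (rule card_eq_by_inverse[OF f' g'])
  thus ?thesis by (simp add: card_cartesian_product)
qed

text \<open>Here \<open>u\<close> is the second element of the \<open>R\<close>-class of
  \<open>a\<close>, hence \<open>(a, u)\<close> lies in \<open>T\<close> as well and both relations
  are glued. On the left \<open>a\<close> becomes an \<open>R\<close>-singleton; on the right the
  class of \<open>u\<close> keeps the other \<open>k\<close> elements. The \<open>T\<close>-class of
  \<open>a\<close> may have further elements before \<open>u\<close>.\<close>

lemma rooted_pairs_Suc_slice: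
  assumes u: "a < u" "u < b" and k: "k > 0"
  shows "card {(R, T) \<in> rooted_pairs q (Suc k) a b. is_next R a b u}
    = card (rooted_pairs q 1 a u) * card (rooted_pairs q k u b)"
proof -
  let ?A = "{a..<u} \<times> {a..<u}" and ?B = "{u..<b} \<times> {u..<b}"
  let ?L = "{(R, T) \<in> rooted_pairs q (Suc k) a b. is_next R a b u}"
  let ?P = "rooted_pairs q 1 a u \<times> rooted_pairs q k u b"
  define f :: "(nat \<times> nat) set \<times> (nat \<times> nat) set \<Rightarrow> _" where "f = (\<lambda>(R, T). ((R \<inter> ?A, T \<inter> ?A), (R \<inter> ?B, T \<inter> ?B)))"
  define g where "g = (\<lambda>((R, T), (R', T')). (glue a u R R', glue a u T T'))"
  have subs: "{a..<u} \<subseteq> {a..<b}" "{u..<b} \<subseteq> {a..<b}" using u by auto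
  have f: "f (R, T) \<in> ?P \<and> g (f (R, T)) = (R, T)" if RT: "(R, T) \<in> ?L" for R T
  proof -
    have R: "nc_equiv {a..<b} R" and T: "nc_equiv {a..<b} T" and sub: "R \<subseteq> T" and c: "card (R `` {a}) = Suc k"
      and q: "\<And>x. x \<in> {a..<b} \<Longrightarrow> (a, x) \<notin> R \<Longrightarrow> card (R `` {x}) = q" and n: "is_next R a b u"
      using RT unfolding rooted_pairs_def by auto
    have aa: "(a, a) \<in> R" using nc_equiv_refl[OF R] u by auto
    have au: "(a, u) \<in> R" using n u unfolding is_next_def by blast
    have nx: "(a, x) \<in> R \<Longrightarrow> x < u \<Longrightarrow> x = a" for x using n unfolding is_next_def by (metis not_le)
    have dom: "(x, y) \<in> R \<Longrightarrow> a \<le> x \<and> x < b \<and> a \<le> y \<and> y < b" for x y using nc_equiv_dom[OF R] by force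
    have ua: "(u, x) \<in> R \<longleftrightarrow> (a, x) \<in> R" for x
      using nc_equiv_trans[OF R au, of x] nc_equiv_trans[OF R nc_equiv_sym[OF R au], of x] by blast
    have A1: "(R \<inter> ?A) `` {a} = {a}" using nx aa u dom by auto
    have A2: "(R \<inter> ?A) `` {x} = R `` {x}" if "x \<in> {a..<u}" "x \<noteq> a" for x
    proof -
      have "y < u" if "(x, y) \<in> R" for y
        using that is_next_no_cross(1)[OF R n, of x y] \<open>x \<in> {a..<u}\<close> \<open>x \<noteq> a\<close> by (auto simp: not_le[symmetric])
      thus ?thesis using \<open>x \<in> {a..<u}\<close> dom[of x] by auto
    qed
    have B1: "(R \<inter> ?B) `` {u} = R `` {a} - {a}"
      using u n dom unfolding is_next_def by (auto simp: ua)
    have B2: "(R \<inter> ?B) `` {x} = R `` {x}" if "x \<in> {u..<b}" "(a, x) \<notin> R" for x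
    proof -
      have "u \<le> y" if xy: "(x, y) \<in> R" for y
      proof (rule ccontr)
        assume "\<not> u \<le> y"
        moreover have "y \<noteq> a" using nc_equiv_sym[OF R xy] \<open>(a, x) \<notin> R\<close> by blast
        ultimately show False
          using is_next_no_cross(2)[OF R n, of y x] dom[OF xy] xy \<open>x \<in> {u..<b}\<close> by auto
      qed
      thus ?thesis using \<open>x \<in> {u..<b}\<close> dom[of x] by auto
    qed
    \<comment> \<open>An infinite set has \<open>card\<close> 0, so the positive cardinality forces
      finiteness.\<close>
    have fin: "finite (R `` {a})" using c card.infinite by fastforce
    have cB: "card ((R \<inter> ?B) `` {u}) = k" unfolding B1 using c aa fin by simp
    have p1: "(R \<inter> ?A, T \<inter> ?A) \<in> rooted_pairs q 1 a u"
    proof -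
      have "card ((R \<inter> ?A) `` {x}) = q" if "x \<in> {a..<u}" "(a, x) \<notin> R \<inter> ?A" for x
      proof -
        have "x \<noteq> a" using that u aa by auto
        moreover have "(a, x) \<notin> R" using that u by auto
        ultimately show ?thesis using A2[OF that(1)] q[of x] that(1) u by auto
      qed
      thus ?thesis unfolding rooted_pairs_def
        using nc_equiv_restrict[OF R subs(1)] nc_equiv_restrict[OF T subs(1)] A1 sub u by auto
    qed
    have p2: "(R \<inter> ?B, T \<inter> ?B) \<in> rooted_pairs q k u b"
    proof -
      have "card ((R \<inter> ?B) `` {x}) = q" if "x \<in> {u..<b}" "(u, x) \<notin> R \<inter> ?B" for x
      proof -
        have "(a, x) \<notin> R" using that u ua by auto
        thus ?thesis using B2[OF that(1)] q[of x] that(1) u by auto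
      qed
      thus ?thesis unfolding rooted_pairs_def
        using nc_equiv_restrict[OF R subs(2)] nc_equiv_restrict[OF T subs(2)] cB sub u by auto
    qed
    have "glue a u (R \<inter> ?A) (R \<inter> ?B) = R" "glue a u (T \<inter> ?A) (T \<inter> ?B) = T"
      using glue_restrict[OF R au u(1)] glue_restrict[OF T _ u(1)] au sub by blast+
    thus ?thesis using p1 p2 by (simp add: f_def g_def)
  qed
  have g: "g ((R, T), (R', T')) \<in> ?L \<and> f (g ((R, T), (R', T'))) = ((R, T), (R', T'))"
    if RT: "(R, T) \<in> rooted_pairs q 1 a u" "(R', T') \<in> rooted_pairs q k u b" for R T R' T'
  proof -
    have R: "nc_equiv {a..<u} R" and T: "nc_equiv {a..<u} T" and sub: "R \<subseteq> T" and c: "card (R `` {a}) = 1"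
      and q: "\<And>x. x \<in> {a..<u} \<Longrightarrow> (a, x) \<notin> R \<Longrightarrow> card (R `` {x}) = q"
      and R': "nc_equiv {u..<b} R'" and T': "nc_equiv {u..<b} T'" and sub': "R' \<subseteq> T'" and c': "card (R' `` {u}) = k"
      and q': "\<And>x. x \<in> {u..<b} \<Longrightarrow> (u, x) \<notin> R' \<Longrightarrow> card (R' `` {x}) = q"
      using RT unfolding rooted_pairs_def by auto
    note dom = nc_equiv_subset[OF R] nc_equiv_subset[OF R'] nc_equiv_subset[OF T] nc_equiv_subset[OF T']
    have aa: "(a, a) \<in> R" "(u, u) \<in> R'" using nc_equiv_refl[OF R] nc_equiv_refl[OF R'] u by auto
    have Ra: "R `` {a} = {a}"
    proof -
      obtain z where "R `` {a} = {z}" using c by (auto simp: card_1_singleton_iff)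
      moreover have "a \<in> R `` {a}" using aa by blast
      ultimately show ?thesis by simp
    qed
    note nc = nc_equiv_glue[OF R R' u(1)] nc_equiv_glue[OF T T' u(1)]
    have fin: "finite (R' `` {u})" using c' k card.infinite by fastforce
    have "glue a u R R' `` {a} = insert a (R' `` {u})" using dom u Ra aa by (auto simp: glue_def)
    moreover have "a \<notin> R' `` {u}" using dom u by auto
    ultimately have cg: "card (glue a u R R' `` {a}) = Suc k" using c' fin by simp
    have qg: "card (glue a u R R' `` {x}) = q" if "x \<in> {a..<b}" "(a, x) \<notin> glue a u R R'" for x
    proof (cases "x < u")
      case True
      hence "(a, x) \<notin> R" using that by (auto simp: glue_def)
      moreover from this have "glue a u R R' `` {x} = R `` {x}" using True dom by (auto simp: glue_def)
      ultimately show ?thesis using q[of x] True that by auto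
    next
      case False
      hence "(u, x) \<notin> R'" using that aa by (auto simp: glue_def)
      moreover from this have "glue a u R R' `` {x} = R' `` {x}" using False dom by (auto simp: glue_def)
      ultimately show ?thesis using q'[of x] False that by auto
    qed
    have nx: "is_next (glue a u R R') a b u"
      unfolding is_next_def using u aa Ra dom by (auto simp: glue_def)
    have "g ((R, T), (R', T')) \<in> ?L"
      unfolding g_def rooted_pairs_def using nc glue_mono[OF sub sub'] cg qg nx u by auto
    moreover have "f (g ((R, T), (R', T'))) = ((R, T), (R', T'))"
      unfolding f_def g_def
      using restrict_glue[OF dom(1,2)] restrict_glue[OF dom(3,4)] by simp
    ultimately show ?thesis by blast
  qed
  have f': "f x \<in> ?P \<and> g (f x) = x" if "x \<in> ?L" for x
    using that f by (cases x) blast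
  have g': "g x \<in> ?L \<and> f (g x) = x" if "x \<in> ?P" for x
  proof -
    obtain R T R' T' where x: "x = ((R, T), (R', T'))" by (metis surj_pair)
    show ?thesis unfolding x by (rule g) (use that x in auto)
  qed
  have "card ?L = card ?P" by (rule card_eq_by_inverse[OF f' g'])
  thus ?thesis by (simp add: card_cartesian_product)
qed

section \<open>Recurrences by summing over the cut point\<close>

lemma finite_nc_pairs: "finite {(R, T). nc_equiv {a..<b} R \<and> nc_equiv {a..<b} T}"
  by (rule finite_subset[of _ "Pow ({a..<b} \<times> {a..<b}) \<times> Pow ({a..<b} \<times> {a..<b})"])
    (use nc_equiv_subset in auto)

lemma finite_rooted_pairs: "finite (rooted_pairs q k a b)"
  by (rule finite_subset[OF _ finite_nc_pairs[of a b]]) (auto simp: rooted_pairs_def)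

lemma uniform_pairs_empty: "uniform_pairs q a a = {({}, {})}"
proof -
  have "nc_equiv {} {}" by (rule nc_equivI) auto
  thus ?thesis using nc_equiv_subset by (fastforce simp: uniform_pairs_def)
qed

text \<open>Elements related to \<open>a\<close> share its class, so fixing the root size at
  \<open>q\<close> covers them too. This closes the system of recurrences.\<close>

lemma uniform_pairs_eq_rooted:
  assumes "a < b"
  shows "uniform_pairs q a b = rooted_pairs q q a b"
proof -
  have "R `` {x} = R `` {a}" if "nc_equiv {a..<b} R" "(a, x) \<in> R" for R x
    using equiv_class_eq[of "{a..<b}" R a x] that unfolding nc_equiv_def by blast
  thus ?thesis using assms unfolding uniform_pairs_def rooted_pairs_def by fastforce
qed

lemma card_slices:
  assumes "finite L" "\<And>x. x \<in> L \<Longrightarrow> \<exists>v\<in>V. Q x v" "finite V"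
    and "\<And>x v w. x \<in> L \<Longrightarrow> Q x v \<Longrightarrow> Q x w \<Longrightarrow> v = w"
  shows "card L = (\<Sum>v\<in>V. card {x \<in> L. Q x v})"
proof -
  have "L = (\<Union>v\<in>V. {x \<in> L. Q x v})" using assms(2) by blast
  hence "card L = card (\<Union>v\<in>V. {x \<in> L. Q x v})" by simp
  also have "\<dots> = (\<Sum>v\<in>V. card {x \<in> L. Q x v})"
    by (rule card_UN_disjoint) (use assms in auto)
  finally show ?thesis .
qed

lemma card_rooted_pairs_1:
  assumes "a < b"
  shows "card (rooted_pairs q 1 a b)
    = (\<Sum>v\<in>{Suc a..b}. card (uniform_pairs q (Suc a) v) * card (uniform_pairs q v b))"
proof -
  let ?L = "rooted_pairs q 1 a b"
  have "card ?L = (\<Sum>v\<in>{Suc a..b}. card {x \<in> ?L. is_next (snd x) a b v})"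
  proof (rule card_slices[OF finite_rooted_pairs])
    fix x assume x: "x \<in> ?L"
    then obtain v where "is_next (snd x) a b v"
      using is_next_exists[of a b "snd x"] unfolding rooted_pairs_def by auto
    thus "\<exists>v\<in>{Suc a..b}. is_next (snd x) a b v" by (auto simp: is_next_def)
    fix v w assume "is_next (snd x) a b v" "is_next (snd x) a b w"
    thus "v = w" using is_next_unique by blast
  qed auto
  also have "\<dots> = (\<Sum>v\<in>{Suc a..b}. card (uniform_pairs q (Suc a) v) * card (uniform_pairs q v b))"
  proof (rule sum.cong[OF refl])
    fix v assume "v \<in> {Suc a..b}"
    moreover have "{x \<in> ?L. is_next (snd x) a b v} = {(R, T) \<in> ?L. is_next T a b v}" by auto
    ultimately show "card {x \<in> ?L. is_next (snd x) a b v}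
        = card (uniform_pairs q (Suc a) v) * card (uniform_pairs q v b)"
      using rooted_pairs_1_slice[of a v b q] by simp
  qed
  finally show ?thesis .
qed

text \<open>The sum stops before \<open>b\<close>: a class with at least two elements has a genuine
  second element, whereas for \<open>k = 1\<close> the cut is governed by \<open>T\<close> and
  \<open>b\<close> may occur.\<close>

lemma card_rooted_pairs_Suc:
  assumes "a < b" "k > 0"
  shows "card (rooted_pairs q (Suc k) a b)
    = (\<Sum>u\<in>{Suc a..<b}. card (rooted_pairs q 1 a u) * card (rooted_pairs q k u b))"
proof -
  let ?L = "rooted_pairs q (Suc k) a b"
  have "card ?L = (\<Sum>u\<in>{Suc a..<b}. card {x \<in> ?L. is_next (fst x) a b u})"
  proof (rule card_slices[OF finite_rooted_pairs])
    fix x assume x: "x \<in> ?L"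
    have R: "nc_equiv {a..<b} (fst x)" and c: "card (fst x `` {a}) = Suc k"
      using x unfolding rooted_pairs_def by auto
    obtain u where u: "is_next (fst x) a b u" using is_next_exists[OF R assms(1)] by auto
    have "u \<noteq> b"
    proof
      assume "u = b"
      hence "fst x `` {a} \<subseteq> {a}" using u nc_equiv_dom[OF R] unfolding is_next_def by fastforce
      hence "card (fst x `` {a}) \<le> card {a}" by (intro card_mono) auto
      thus False using c assms(2) by simp
    qed
    thus "\<exists>u\<in>{Suc a..<b}. is_next (fst x) a b u" using u by (auto simp: is_next_def)
    fix v w assume "is_next (fst x) a b v" "is_next (fst x) a b w"
    thus "v = w" using is_next_unique by blast
  qed auto
  also have "\<dots> = (\<Sum>u\<in>{Suc a..<b}. card (rooted_pairs q 1 a u) * card (rooted_pairs q k u b))"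
  proof (rule sum.cong[OF refl])
    fix u assume "u \<in> {Suc a..<b}"
    moreover have "{x \<in> ?L. is_next (fst x) a b u} = {(R, T) \<in> ?L. is_next R a b u}" by auto
    ultimately show "card {x \<in> ?L. is_next (fst x) a b u}
        = card (rooted_pairs q 1 a u) * card (rooted_pairs q k u b)"
      using rooted_pairs_Suc_slice[of a u b k q] assms(2) by simp
  qed
  finally show ?thesis .
qed

section \<open>Translation invariance of the counts\<close>

lemma sum_shift_interval: "(\<Sum>v\<in>{a + i..<a + j}. f v) = (\<Sum>v\<in>{i..<j}. f (a + v))" for a i j :: nat
  using sum.shift_bounds_nat_ivl[of f i a j] by (simp add: add.commute)

text \<open>Instead of translating relations, strong induction on the length uses the recurrences:
  they reduce the count to counts on shorter intervals, which may be moved to start at 0. Both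
  families are treated together because each recurrence for one leads to the other.\<close>

lemma card_pairs_shift:
  assumes "q > 0"
  shows "card (uniform_pairs q a (a + m)) = card (uniform_pairs q 0 m) \<and>
    (\<forall>k>0. card (rooted_pairs q k a (a + m)) = card (rooted_pairs q k 0 m))"
proof (induction m arbitrary: a rule: less_induct)
  case (less m)
  have U: "card (uniform_pairs q c (c + i)) = card (uniform_pairs q 0 i)"
    and H: "k > 0 \<Longrightarrow> card (rooted_pairs q k c (c + i)) = card (rooted_pairs q k 0 i)"
    if "i < m" for c i k using less[OF that] by auto
  show ?case
  proof (cases "m = 0")
    case True
    thus ?thesis by (simp add: uniform_pairs_empty rooted_pairs_def)
  next
    case False
    have R1: "card (rooted_pairs q 1 a (a + m))
       = (\<Sum>i\<in>{1..<Suc m}. card (uniform_pairs q 0 (i - 1)) * card (uniform_pairs q 0 (m - i)))" for a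
    proof -
      \<comment> \<open>The bound \<open>a + Suc m\<close> admits the cut at the right end
        \<open>a + m\<close>. The pieces have lengths \<open>i - 1\<close> and \<open>m - i\<close>,
        both smaller than \<open>m\<close>.\<close>
      have "card (rooted_pairs q 1 a (a + m))
        = (\<Sum>v\<in>{a + 1..<a + Suc m}. card (uniform_pairs q (Suc a) v) * card (uniform_pairs q v (a + m)))"
        using card_rooted_pairs_1[of a "a + m" q] False by (simp add: atLeastLessThanSuc_atLeastAtMost)
      also have "\<dots> = (\<Sum>i\<in>{1..<Suc m}. card (uniform_pairs q (Suc a) (a + i)) * card (uniform_pairs q (a + i) (a + m)))"
        by (rule sum_shift_interval)
      also have "\<dots> = (\<Sum>i\<in>{1..<Suc m}. card (uniform_pairs q 0 (i - 1)) * card (uniform_pairs q 0 (m - i)))"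
      proof (rule sum.cong[OF refl])
        fix i assume "i \<in> {1..<Suc m}"
        thus "card (uniform_pairs q (Suc a) (a + i)) * card (uniform_pairs q (a + i) (a + m))
          = card (uniform_pairs q 0 (i - 1)) * card (uniform_pairs q 0 (m - i))"
          using U[of "i - 1" "Suc a"] U[of "m - i" "a + i"] by auto
      qed
      finally show ?thesis .
    qed
    have RS: "card (rooted_pairs q (Suc k) a (a + m))
       = (\<Sum>i\<in>{1..<m}. card (rooted_pairs q 1 0 i) * card (rooted_pairs q k 0 (m - i)))" if "k > 0" for a k
    proof -
      have "card (rooted_pairs q (Suc k) a (a + m))
        = (\<Sum>v\<in>{a + 1..<a + m}. card (rooted_pairs q 1 a v) * card (rooted_pairs q k v (a + m)))"
        using card_rooted_pairs_Suc[of a "a + m" k q] False that by simp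
      also have "\<dots> = (\<Sum>i\<in>{1..<m}. card (rooted_pairs q 1 a (a + i)) * card (rooted_pairs q k (a + i) (a + m)))"
        by (rule sum_shift_interval)
      also have "\<dots> = (\<Sum>i\<in>{1..<m}. card (rooted_pairs q 1 0 i) * card (rooted_pairs q k 0 (m - i)))"
      proof (rule sum.cong[OF refl])
        fix i assume "i \<in> {1..<m}"
        thus "card (rooted_pairs q 1 a (a + i)) * card (rooted_pairs q k (a + i) (a + m))
          = card (rooted_pairs q 1 0 i) * card (rooted_pairs q k 0 (m - i))"
          using H[of i 1 a] H[of "m - i" k "a + i"] that by auto
      qed
      finally show ?thesis .
    qed
    have rooted: "card (rooted_pairs q k a (a + m)) = card (rooted_pairs q k 0 m)" if k: "k > 0" for k
    proof (cases "k = 1")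
      case True
      thus ?thesis using R1[of a] R1[of 0] by simp
    next
      case False
      then obtain j where "k = Suc j" "j > 0" using k by (cases k) auto
      thus ?thesis using RS[of j a] RS[of j 0] by simp
    qed
    moreover have "card (uniform_pairs q a (a + m)) = card (uniform_pairs q 0 m)"
      using rooted[OF assms] False by (simp add: uniform_pairs_eq_rooted)
    ultimately show ?thesis by blast
  qed
qed

section \<open>Generating functions\<close>

text \<open>The series called \<open>c\<close> in the overview; \<open>rooted_fps q k\<close> is
  \<open>h\<^sub>k\<close>.\<close>

definition uniform_fps :: "nat \<Rightarrow> real fps" where
  "uniform_fps q = Abs_fps (\<lambda>m. real (card (uniform_pairs q 0 m)))"

definition rooted_fps :: "nat \<Rightarrow> nat \<Rightarrow> real fps" where
  "rooted_fps q k = Abs_fps (\<lambda>m. real (card (rooted_pairs q k 0 m)))"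

text \<open>The factor \<open>fps_X\<close> accounts for the point \<open>a\<close>: with
  \<open>v = Suc i\<close> the two pieces have lengths \<open>i\<close> and \<open>l - i\<close>,
  one less than \<open>m\<close> in total.\<close>

lemma rooted_fps_1:
  assumes "q > 0"
  shows "rooted_fps q 1 = fps_X * uniform_fps q ^ 2"
proof (rule fps_ext)
  fix m
  show "fps_nth (rooted_fps q 1) m = fps_nth (fps_X * uniform_fps q ^ 2) m"
  proof (cases m)
    case 0
    thus ?thesis by (simp add: rooted_fps_def rooted_pairs_def)
  next
    case (Suc l)
    have "card (rooted_pairs q 1 0 m)
        = (\<Sum>v\<in>{Suc 0..Suc l}. card (uniform_pairs q 1 v) * card (uniform_pairs q v m))"
      using card_rooted_pairs_1[of 0 m q] Suc by simp
    also have "\<dots> = (\<Sum>i=0..l. card (uniform_pairs q 1 (Suc i)) * card (uniform_pairs q (Suc i) m))"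
      by (rule sum.shift_bounds_cl_Suc_ivl)
    also have "\<dots> = (\<Sum>i=0..l. card (uniform_pairs q 0 i) * card (uniform_pairs q 0 (l - i)))"
    proof (rule sum.cong[OF refl])
      fix i assume "i \<in> {0..l}"
      thus "card (uniform_pairs q 1 (Suc i)) * card (uniform_pairs q (Suc i) m)
          = card (uniform_pairs q 0 i) * card (uniform_pairs q 0 (l - i))"
        using card_pairs_shift[OF assms, of 1 i] card_pairs_shift[OF assms, of "Suc i" "l - i"] Suc by simp
    qed
    also have "real \<dots> = fps_nth (uniform_fps q ^ 2) l"
      by (simp add: uniform_fps_def power2_eq_square fps_mult_nth)
    finally show ?thesis by (simp add: Suc rooted_fps_def)
  qed
qed

lemma rooted_fps_Suc:
  assumes "q > 0" "k > 0"
  shows "rooted_fps q (Suc k) = rooted_fps q 1 * rooted_fps q k"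
proof (rule fps_ext)
  fix m
  have z: "card (rooted_pairs q j 0 0) = 0" for j by (simp add: rooted_pairs_def)
  show "fps_nth (rooted_fps q (Suc k)) m = fps_nth (rooted_fps q 1 * rooted_fps q k) m"
  proof (cases "m = 0")
    case True
    thus ?thesis by (simp add: rooted_fps_def z)
  next
    case False
    have "card (rooted_pairs q (Suc k) 0 m)
        = (\<Sum>u\<in>{Suc 0..<m}. card (rooted_pairs q 1 0 u) * card (rooted_pairs q k u m))"
      using card_rooted_pairs_Suc[of 0 m k q] False assms by simp
    also have "\<dots> = (\<Sum>u\<in>{Suc 0..<m}. card (rooted_pairs q 1 0 u) * card (rooted_pairs q k 0 (m - u)))"
    proof (rule sum.cong[OF refl])
      fix u assume "u \<in> {Suc 0..<m}"
      thus "card (rooted_pairs q 1 0 u) * card (rooted_pairs q k u m)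
          = card (rooted_pairs q 1 0 u) * card (rooted_pairs q k 0 (m - u))"
        using card_pairs_shift[OF assms(1), of u "m - u"] assms(2) by simp
    qed
    \<comment> \<open>The added terms \<open>u = 0\<close> and \<open>u = m\<close> contain the
      count for an empty interval, which is 0; the sum is now a Cauchy product.\<close>
    also have "\<dots> = (\<Sum>u=0..m. card (rooted_pairs q 1 0 u) * card (rooted_pairs q k 0 (m - u)))"
    proof (rule sum.mono_neutral_left)
      show "\<forall>i\<in>{0..m} - {Suc 0..<m}. card (rooted_pairs q 1 0 i) * card (rooted_pairs q k 0 (m - i)) = 0"
      proof
        fix i assume "i \<in> {0..m} - {Suc 0..<m}"
        hence "i = 0 \<or> i = m" by auto
        thus "card (rooted_pairs q 1 0 i) * card (rooted_pairs q k 0 (m - i)) = 0" using z by auto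
      qed
    qed auto
    finally show ?thesis by (simp add: rooted_fps_def fps_mult_nth)
  qed
qed

lemma rooted_fps_power:
  assumes "q > 0" "k > 0"
  shows "rooted_fps q k = (fps_X * uniform_fps q ^ 2) ^ k"
  using assms(2)
proof (induction k rule: nat_induct_non_zero)
  case 1
  thus ?case using rooted_fps_1[OF assms(1)] by simp
next
  case (Suc k)
  thus ?case using rooted_fps_Suc[OF assms(1), of k] rooted_fps_1[OF assms(1)] by simp
qed

lemma uniform_fps_equation:
  assumes "q > 0"
  shows "uniform_fps q = 1 + fps_X ^ q * uniform_fps q ^ (2 * q)"
proof -
  have "uniform_fps q = 1 + rooted_fps q q"
  proof (rule fps_ext)
    fix m
    show "fps_nth (uniform_fps q) m = fps_nth (1 + rooted_fps q q) m"
    proof (cases "m = 0")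
      case True
      thus ?thesis by (simp add: uniform_fps_def rooted_fps_def uniform_pairs_empty rooted_pairs_def)
    next
      case False
      thus ?thesis by (simp add: uniform_fps_def rooted_fps_def uniform_pairs_eq_rooted)
    qed
  qed
  also have "rooted_fps q q = fps_X ^ q * uniform_fps q ^ (2 * q)"
    unfolding rooted_fps_power[OF assms assms] power_mult_distrib power_mult ..
  finally show ?thesis .
qed

section \<open>Raney numbers as coefficients of powers\<close>

text \<open>The Raney numbers satisfy the recurrence that
  \<open>c ^ Suc r = c ^ r + fps_X ^ q * c ^ (r + p)\<close> imposes on coefficients. Both terms on
  the right have the same upper index, since \<open>p * Suc n + r = p * n + (r + p)\<close>, and
  Pascal's rule splits the left side.\<close>

lemma raney_recurrence:
  fixes p n r :: nat
  assumes "p > 0" and M: "M = p * Suc n + r"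
  shows "real (Suc r) / real (Suc M) * real (Suc M choose Suc n)
    = real r / real M * real (M choose Suc n) + real (r + p) / real M * real (M choose n)"
proof -
  define x y where "x = real (M choose n)" and "y = real (M choose Suc n)"
  have "1 * Suc n \<le> p * Suc n" using assms(1) by (intro mult_le_mono1) simp
  hence nM: "Suc n \<le> M" unfolding M by simp
  \<comment> \<open>Absorption expresses \<open>y\<close> through \<open>x\<close>, leaving a
    rational identity in \<open>x\<close> alone.\<close>
  have "Suc n * (M choose Suc n) = (M - n) * (M choose n)"
    by (simp only: binomial_absorption binomial_absorb_comp)
  hence "real (Suc n) * y = real (M - n) * x"
    unfolding x_def y_def by (metis of_nat_mult)
  hence "(real n + 1) * y = (real M - real n) * x" using nM by (simp add: of_nat_diff add.commute)
  hence y: "y = (real M - real n) * x / (real n + 1)" by (simp add: field_simps)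
  have Mr: "real M = real p * (real n + 1) + real r" unfolding M by (simp add: algebra_simps)
  have M0: "real M > 0" using nM by simp
  have "(real r + 1) / (real M + 1) * (x + y) = (real r + 1) * x / (real n + 1)"
    using M0 unfolding y by (simp add: divide_simps) (simp add: algebra_simps)
  also have "\<dots> = real M * (real r + 1) * x / (real M * (real n + 1))"
    using M0 by simp
  also have "real M * (real r + 1) = real r * (real M - real n) + (real r + real p) * (real n + 1)"
    unfolding Mr by (simp add: algebra_simps)
  also have "\<dots> * x / (real M * (real n + 1)) = real r / real M * y + (real r + real p) / real M * x"
    using M0 unfolding y by (simp add: divide_simps) (simp add: algebra_simps)
  finally show ?thesis by (simp add: x_def y_def add.commute)
qed

text \<open>Outer induction on \<open>n\<close> for all exponents, inner induction on
  \<open>r\<close>. At \<open>n = r = 0\<close> the coefficient is 1, while the formula evaluates to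
  0 because division by zero gives 0; this case is excluded.\<close>

lemma fuss_fps_nth:
  fixes c :: "real fps"
  assumes c: "c = 1 + fps_X ^ q * c ^ p" and "q > 0" "p > 0" and "n > 0 \<or> r > 0"
  shows "fps_nth (c ^ r) (q * n) = real r / real (p * n + r) * real ((p * n + r) choose n)"
  using assms(4)
proof (induction n arbitrary: r)
  case 0
  have "fps_nth c 0 = 1" using assms(2) by (subst c) simp
  thus ?case using 0 by (simp add: fps_power_zeroth)
next
  case (Suc n)
  note IH = Suc.IH
  show ?case
  proof (induction r)
    case 0
    \<comment> \<open>The series \<open>c ^ 0\<close> is 1 and has coefficient 0 at the positive
      index \<open>q * Suc n\<close>.\<close>
    thus ?case using assms(2) by simp
  next
    case (Suc r)
    have "c ^ Suc r = c ^ r * (1 + fps_X ^ q * c ^ p)" using c by simp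
    also have "\<dots> = c ^ r + fps_X ^ q * c ^ (r + p)" by (simp add: algebra_simps power_add)
    finally have "fps_nth (c ^ Suc r) (q * Suc n)
        = fps_nth (c ^ r) (q * Suc n) + fps_nth (c ^ (r + p)) (q * n)"
      by (simp add: fps_X_power_mult_nth)
    \<comment> \<open>The first term comes from the inner induction, the second from the outer one
      at exponent \<open>r + p\<close>, which is positive.\<close>
    also have "\<dots> = real r / real (p * Suc n + r) * real ((p * Suc n + r) choose Suc n)
        + real (r + p) / real (p * n + (r + p)) * real ((p * n + (r + p)) choose n)"
      using IH[of "r + p"] Suc.IH assms(3) by simp
    also have "p * n + (r + p) = p * Suc n + r" by simp
    also note raney_recurrence[OF assms(3) refl, of r n, symmetric]
    finally show ?case by simp
  qed
qed

section \<open>Partitions and equivalence relations\<close>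

text \<open>For partitions of a set \<open>S\<close> this inverts the passage from an equivalence
  relation to its quotient \<open>S // R\<close>.\<close>

definition block_rel :: "'a set set \<Rightarrow> ('a \<times> 'a) set" where
  "block_rel P = {(x, y). \<exists>B\<in>P. x \<in> B \<and> y \<in> B}"

lemma block_rel_class:
  assumes "partition_on S P" "B \<in> P" "x \<in> B"
  shows "block_rel P `` {x} = B"
  using partition_onD2[OF assms(1)] assms(2,3) by (auto simp: block_rel_def disjoint_def)

lemma block_rel_quotient:
  assumes "equiv S R"
  shows "block_rel (S // R) = R"
proof (intro equalityI subrelI)
  fix x y assume "(x, y) \<in> block_rel (S // R)"
  thus "(x, y) \<in> R" using quotient_eq_iff[OF assms] by (auto simp: block_rel_def)
next
  fix x y assume xy: "(x, y) \<in> R"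
  hence "x \<in> S" using assms by (auto simp: equiv_def)
  hence "R `` {x} \<in> S // R" "x \<in> R `` {x}" using equiv_class_self[OF assms] by (auto intro: quotientI)
  thus "(x, y) \<in> block_rel (S // R)" using xy by (auto simp: block_rel_def)
qed

lemma block_rel_nc_equiv:
  assumes "planar_partition N P"
  shows "nc_equiv {1..<Suc N} (block_rel P)"
proof -
  have part: "partition_on {1..<Suc N} P"
    using assms by (simp add: planar_partition_def atLeastLessThanSuc_atLeastAtMost)
  have "(w, x) \<in> block_rel P"
    if o: "w < x" "x < y" "y < z" and wy: "(w, y) \<in> block_rel P" and xz: "(x, z) \<in> block_rel P" for w x y z
  proof -
    obtain A B where "A \<in> P" "w \<in> A" "y \<in> A" "B \<in> P" "x \<in> B" "z \<in> B"
      using wy xz by (auto simp: block_rel_def)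
    moreover from this have "A = B" using assms o unfolding planar_partition_def by blast
    ultimately show ?thesis by (auto simp: block_rel_def)
  qed
  thus ?thesis using equiv_partition_on[OF part] unfolding nc_equiv_def block_rel_def[symmetric] by blast
qed

lemma planar_partition_quotient:
  assumes "nc_equiv {1..<Suc N} R"
  shows "planar_partition N ({1..<Suc N} // R)"
proof -
  have e: "equiv {1..<Suc N} R" using assms by (simp add: nc_equiv_def)
  note cls = quotient_eq_iff[OF e]
  have "A = B" if "w < x" "x < y" "y < z" "A \<in> {1..<Suc N} // R" "B \<in> {1..<Suc N} // R"
    "w \<in> A" "y \<in> A" "x \<in> B" "z \<in> B" for w x y z A B
    using nc_equiv_nc[OF assms that(1-3)] cls[of A A w y] cls[of B B x z] cls[of A B w x] that by blast
  thus ?thesis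
    using partition_on_quotient[OF e]
    unfolding planar_partition_def atLeastLessThanSuc_atLeastAtMost by blast
qed

text \<open>Under \<open>block_rel\<close>, refinement becomes inclusion, planarity becomes the
  noncrossing condition, and block sizes become class sizes. Forming quotients is the inverse
  map.\<close>

lemma card_planar_pairs:
  "card {(P1, P2). planar_partition (q * n) P1 \<and> planar_partition (q * n) P2 \<and>
      refines {1..q * n} P1 P2 \<and> q_partition q n P1} = card (uniform_pairs q 1 (Suc (q * n)))"
    (is "card ?L = card ?U")
proof -
  let ?S = "{1..<Suc (q * n)}"
  have S: "{1..q * n} = ?S" by auto
  define f where "f = (\<lambda>(P1, P2). (block_rel P1 :: (nat \<times> nat) set, block_rel P2 :: (nat \<times> nat) set))"
  define g where "g = (\<lambda>(R, T). (?S // R, ?S // T))"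
  have f: "f (P1, P2) \<in> ?U \<and> g (f (P1, P2)) = (P1, P2)" if "(P1, P2) \<in> ?L" for P1 P2
  proof -
    have p: "planar_partition (q * n) P1" "planar_partition (q * n) P2" and r: "refines ?S P1 P2"
      and qp: "\<And>B. B \<in> P1 \<Longrightarrow> card B = q"
      using that unfolding q_partition_def S by auto
    have part: "partition_on ?S P1" "partition_on ?S P2"
      using p unfolding planar_partition_def S by auto
    have "block_rel P1 \<subseteq> block_rel P2"
    proof (rule subrelI)
      fix x y assume "(x, y) \<in> block_rel P1"
      then obtain B where "B \<in> P1" "x \<in> B" "y \<in> B" by (auto simp: block_rel_def)
      moreover from this obtain C where "C \<in> P2" "B \<subseteq> C" using r by (auto simp: refines_def)
      ultimately show "(x, y) \<in> block_rel P2" by (auto simp: block_rel_def)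
    qed
    moreover have "card (block_rel P1 `` {x}) = q" if x: "x \<in> ?S" for x
    proof -
      obtain B where "B \<in> P1" "x \<in> B" using partition_onD1[OF part(1)] x by blast
      thus ?thesis using block_rel_class[OF part(1)] qp by simp
    qed
    moreover have "?S // block_rel P1 = P1" "?S // block_rel P2 = P2"
      using partition_on_eq_quotient part unfolding block_rel_def by blast+
    ultimately show ?thesis
      using block_rel_nc_equiv[OF p(1)] block_rel_nc_equiv[OF p(2)]
      by (simp add: f_def g_def uniform_pairs_def)
  qed
  have g: "g (R, T) \<in> ?L \<and> f (g (R, T)) = (R, T)" if "(R, T) \<in> ?U" for R T
  proof -
    have R: "nc_equiv ?S R" and T: "nc_equiv ?S T" and sub: "R \<subseteq> T"
      and c: "\<And>x. x \<in> ?S \<Longrightarrow> card (R `` {x}) = q"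
      using that by (auto simp: uniform_pairs_def)
    have e: "equiv ?S R" "equiv ?S T" using R T by (auto simp: nc_equiv_def)
    have "\<exists>Y\<in>?S // T. X \<subseteq> Y" if X: "X \<in> ?S // R" for X
    proof -
      obtain x where "x \<in> ?S" "X = R `` {x}" using X by (rule quotientE)
      thus ?thesis using sub by (intro bexI[of _ "T `` {x}"]) (auto intro: quotientI)
    qed
    hence "refines ?S (?S // R) (?S // T)"
      using partition_on_quotient[OF e(1)] partition_on_quotient[OF e(2)] by (simp add: refines_def)
    moreover have "q_partition q n (?S // R)"
      unfolding q_partition_def S using partition_on_quotient[OF e(1)] c by (auto elim!: quotientE)
    ultimately show ?thesis
      using planar_partition_quotient[OF R] planar_partition_quotient[OF T]
        block_rel_quotient[OF e(1)] block_rel_quotient[OF e(2)]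
      unfolding f_def g_def S by simp
  qed
  have f': "f x \<in> ?U \<and> g (f x) = x" if "x \<in> ?L" for x
    using that f by (cases x) blast
  have g': "g x \<in> ?L \<and> f (g x) = x" if "x \<in> ?U" for x
  proof -
    obtain R T where x: "x = (R, T)" by (cases x)
    show ?thesis unfolding x by (rule g) (use that x in auto)
  qed
  show ?thesis by (rule card_eq_by_inverse[OF f' g'])
qed

theorem theorem2:
  fixes q n p :: nat
  assumes "q > 0" and "n > 0" and "p = 2 * q"
  shows "real (card {(P1, P2). planar_partition (q * n) P1 \<and> planar_partition (q * n) P2 \<and>
                       refines {1..q * n} P1 P2 \<and> q_partition q n P1}) = fuss_catalan p n"
proof -
  \<comment> \<open>The interval from 1 to \<open>q * n\<close> has length \<open>q * n\<close> and
    is moved to start at 0.\<close>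
  have "real (card (uniform_pairs q 1 (Suc (q * n)))) = fps_nth (uniform_fps q) (q * n)"
    using card_pairs_shift[OF assms(1), of 1 "q * n"] by (simp add: uniform_fps_def)
  \<comment> \<open>The Raney number with \<open>r = 1\<close> is the Fuss-Catalan number.\<close>
  also have "\<dots> = fuss_catalan p n"
    using fuss_fps_nth[OF uniform_fps_equation[OF assms(1)] assms(1), of n 1] assms
    by (simp add: fuss_catalan_def)
  finally show ?thesis unfolding card_planar_pairs .
qed

end
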